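(* Let $G$ be a nontrivial traceable graph of order $n$ and let $\ell\geq 1$ be an integer. Then $pc_{1,\ell}(P_\alpha(G))\leq \ell+1$ for each permutation $\alpha$ of $[n]=\{1,2,\dots,n\}$.
   Context: All graphs are finite, undirected and simple; a graph is nontrivial if it has at least two vertices, and traceable if it contains a Hamiltonian path. Let $G$ have $V(G)=\{v_1,\dots,v_n\}$, let $\alpha$ be a permutation of $[n]$, and let $G'$ be a (disjoint) copy of $G$ with vertices $u_1,\dots,u_n$, where $u_i$ corresponds to $v_i$. The permutation graph $P_\alpha(G)$ is obtained from $G\cup G'$ by adding all edges $v_iu_{\alpha(i)}$, $1\le i\le n$. An edge-coloring of a graph is an arbitrary map from its edge set to the natural numbers (adjacent edges may share a color). In an edge-colored graph, a path $P$ is a distance $\ell$-proper path if no two edges of $P$ of the same color appear with fewer than $\ell$ edges in between on $P$. For a connected graph $F$, $pc_{1,\ell}(F)$ is the minimum number of colors in an edge-coloring of $F$ such that every pair of distinct vertices of $F$ is connected by at least one distance $\ell$-proper path. *)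

theory Defs
  imports "Graph_Theory.Graph_Theory" "HOL-Combinatorics.Permutations"
begin

text \<open>
  A finite simple undirected graph is a \<^locale>\<open>pair_graph\<close>: a finite vertex set with a
  symmetric irreflexive arc relation. The arcs \<open>(u, v)\<close> and \<open>(v, u)\<close> represent the single
  undirected edge \<open>{u, v}\<close>. Edge-colorings are maps on these undirected edges, so that both
  arcs necessarily carry the same color.
\<close>

definition uedges :: "'a pair_pre_digraph \<Rightarrow> 'a set set" where
  "uedges F = {{x, y} | x y. (x, y) \<in> parcs F}"

definition path_edges :: "'a vwalk \<Rightarrow> 'a set list" where
  "path_edges p = map (\<lambda>(x, y). {x, y}) (vwalk_arcs p)"

definition nontrivial :: "'a pair_pre_digraph \<Rightarrow> bool" where
  "nontrivial F \<longleftrightarrow> 2 \<le> card (pverts F)"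

definition traceable :: "'a pair_pre_digraph \<Rightarrow> bool" where
  "traceable F \<longleftrightarrow> (\<exists>p. vpath p F \<and> set p = pverts F)"

text \<open>
  The vertex \<open>v i\<close> of \<open>G\<close>, for \<open>1 \<le> i \<le> n = card (pverts G)\<close>, is represented by \<open>Inl (v i)\<close>,
  and the corresponding vertex \<open>u i\<close> of the disjoint copy of \<open>G\<close> by \<open>Inr (v i)\<close>.
\<close>

definition permutation_graph ::
  "(nat \<Rightarrow> 'a) \<Rightarrow> (nat \<Rightarrow> nat) \<Rightarrow> 'a pair_pre_digraph \<Rightarrow> ('a + 'a) pair_pre_digraph" where
  "permutation_graph v \<alpha> G =
    \<lparr> pverts = Inl ` pverts G \<union> Inr ` pverts G,
      parcs = {(Inl x, Inl y) | x y. (x, y) \<in> parcs G}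
            \<union> {(Inr x, Inr y) | x y. (x, y) \<in> parcs G}
            \<union> {(Inl (v i), Inr (v (\<alpha> i))) | i. i \<in> {1..card (pverts G)}}
            \<union> {(Inr (v (\<alpha> i)), Inl (v i)) | i. i \<in> {1..card (pverts G)}} \<rparr>"

text \<open>The edges at positions \<open>i < j\<close> of a path have exactly \<open>j - i - 1\<close> edges in between.\<close>

definition distance_proper_path :: "nat \<Rightarrow> ('a set \<Rightarrow> nat) \<Rightarrow> 'a vwalk \<Rightarrow> bool" where
  "distance_proper_path l c p \<longleftrightarrow>
    (\<forall>i j. i < j \<and> j < length (path_edges p) \<and> c (path_edges p ! i) = c (path_edges p ! j)
      \<longrightarrow> \<not> j - i - 1 < l)"

definition distance_proper_connected ::
  "nat \<Rightarrow> 'a pair_pre_digraph \<Rightarrow> ('a set \<Rightarrow> nat) \<Rightarrow> bool" where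
  "distance_proper_connected l F c \<longleftrightarrow>
    (\<forall>x \<in> pverts F. \<forall>y \<in> pverts F. x \<noteq> y \<longrightarrow>
      (\<exists>p. vpath p F \<and> hd p = x \<and> last p = y \<and> distance_proper_path l c p))"

text \<open>
  \<open>pc1 l F\<close> is the number \<open>pc\<close> with subscripts \<open>1, l\<close> of \<open>F\<close>. Only the values of a coloring on
  the edges of \<open>F\<close> count. The number is meaningful for connected \<open>F\<close> only, where by lemma
  \<open>pc1_attained\<close> below the minimum is over a nonempty set.
\<close>

definition pc1 :: "nat \<Rightarrow> 'a pair_pre_digraph \<Rightarrow> nat" where
  "pc1 l F = (LEAST k. \<exists>c. distance_proper_connected l F c \<and> card (c ` uedges F) = k)"

lemma pair_graph_permutation_graph:
  assumes G: "pair_graph G" and v: "bij_betw v {1..card (pverts G)} (pverts G)"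
    and \<alpha>: "\<alpha> permutes {1..card (pverts G)}"
  shows "pair_graph (permutation_graph v \<alpha> G)"
proof -
  interpret pair_graph G by (rule G)
  have vV: "v i \<in> pverts G" "v (\<alpha> i) \<in> pverts G" if "i \<in> {1..card (pverts G)}" for i
    using v permutes_in_image[OF \<alpha>, of i] that by (auto simp: bij_betw_def)
  have V: "finite (pverts (permutation_graph v \<alpha> G))"
    using pair_finite_verts by (simp add: permutation_graph_def)
  have sub: "parcs (permutation_graph v \<alpha> G)
      \<subseteq> pverts (permutation_graph v \<alpha> G) \<times> pverts (permutation_graph v \<alpha> G)"
    using vV by (auto simp: permutation_graph_def dest: in_arcsD1 in_arcsD2)
  have "symmetric (with_proj (permutation_graph v \<alpha> G))"
    using arcs_ends_symmetric[OF pair_sym_arcs]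
    by (auto simp: symmetric_def sym_def permutation_graph_def)
  moreover have "fst e \<noteq> snd e" if "e \<in> parcs (permutation_graph v \<alpha> G)" for e
    using that pair_no_loops by (fastforce simp: permutation_graph_def)
  ultimately show ?thesis
    using V sub finite_subset[OF sub] by unfold_locales auto
qed

lemma set_vwalk_arcs_subset: "set (vwalk_arcs p) \<subseteq> set p \<times> set p"
  by (induction p rule: vwalk_arcs.induct) auto

lemma distinct_path_edges: "distinct p \<Longrightarrow> distinct (path_edges p)"
proof (induction p rule: vwalk_arcs.induct)
  case (3 x y xs)
  have "{x, y} \<noteq> {a, b}" if "(a, b) \<in> set (vwalk_arcs (y # xs))" for a b
    using that set_vwalk_arcs_subset[of "y # xs"] 3(2) by (auto simp: doubleton_eq_iff)
  then show ?case using 3 by (force simp: path_edges_def)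
qed (auto simp: path_edges_def)

lemma pc1_attained:
  assumes F: "pair_graph F" and conn: "connected F"
  obtains c where "distance_proper_connected l F c" "card (c ` uedges F) = pc1 l F"
proof -
  interpret pair_graph F by (rule F)
  have "uedges F = (\<lambda>(x, y). {x, y}) ` parcs F"
    by (auto simp: uedges_def)
  then have "finite (uedges F)"
    using pair_finite_arcs by simp
  then obtain c :: "'a set \<Rightarrow> nat" where c: "inj_on c (uedges F)"
    using finite_imp_inj_to_nat_seg by metis
  have "distance_proper_connected l F c"
    unfolding distance_proper_connected_def
  proof (intro ballI impI)
    fix x y assume xy: "x \<in> pverts F" "y \<in> pverts F"
    have "strongly_connected F"
      using symmetric_connected_imp_strongly_connected[OF pair_sym_arcs conn] .
    then have "x \<rightarrow>\<^sup>*\<^bsub>with_proj F\<^esub> y"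
      using xy by (auto simp: strongly_connected_def)
    then obtain p where p: "vpath p F" "hd p = x" "last p = y"
      using reachable_vpath_conv[of x y] by auto
    have "set (path_edges p) \<subseteq> uedges F"
      using p(1) by (auto simp: vpath_def vwalk_def path_edges_def uedges_def)
    moreover have "distinct (path_edges p)"
      using p(1) distinct_path_edges by (auto simp: vpath_def)
    ultimately have *: "c (path_edges p ! i) \<noteq> c (path_edges p ! j)"
      if "i < j" "j < length (path_edges p)" for i j
    proof -
      have "path_edges p ! i \<in> uedges F" "path_edges p ! j \<in> uedges F"
        using \<open>set (path_edges p) \<subseteq> uedges F\<close> that
        by (meson less_trans nth_mem subsetD)+
      moreover have "path_edges p ! i \<noteq> path_edges p ! j"
        using \<open>distinct (path_edges p)\<close> that by (simp add: nth_eq_iff_index_eq)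
      ultimately show ?thesis
        using c by (simp add: inj_on_eq_iff)
    qed
    have "distance_proper_path l c p"
      unfolding distance_proper_path_def
    proof (intro allI impI)
      fix i j
      assume "i < j \<and> j < length (path_edges p) \<and> c (path_edges p ! i) = c (path_edges p ! j)"
      then show "\<not> j - i - 1 < l"
        using *[of i j] by simp
    qed
    then show "\<exists>p. vpath p F \<and> hd p = x \<and> last p = y \<and> distance_proper_path l c p"
      using p by blast
  qed
  then have "\<exists>k c. distance_proper_connected l F c \<and> card (c ` uedges F) = k"
    by (intro exI conjI) (assumption, rule refl)
  from LeastI_ex[OF this]
  have "\<exists>c. distance_proper_connected l F c \<and> card (c ` uedges F) = pc1 l F"
    by (simp only: pc1_def)
  then show thesis using that by blast
qed

end

theory Submission
  imports Defs
begin

text \<open>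
  Let \<open>x\<^sub>1, \<dots>, x\<^sub>n\<close> be a Hamiltonian path of \<open>G\<close>, let \<open>y\<^sub>1, \<dots>, y\<^sub>n\<close> be its copy, and let \<open>y\<^sub>b\<close>
  be the neighbor of \<open>x\<^sub>1\<close> in the copy. The three legs \<open>y\<^sub>1, \<dots>, y\<^sub>b\<^sub>-\<^sub>1\<close> and \<open>y\<^sub>n, \<dots>, y\<^sub>b\<^sub>+\<^sub>1\<close> and
  \<open>x\<^sub>1, \<dots>, x\<^sub>n\<close> form, together with their common center \<open>y\<^sub>b\<close>, a spanning tree. Color it
  cyclically with \<open>l + 1\<close> colors so that the colors rise by one towards \<open>y\<^sub>b\<close> on the first
  two legs and continue to rise from \<open>y\<^sub>b\<close> along the third. Only a vertex \<open>y\<^sub>i\<close> with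
  \<open>i < b\<close> and a vertex \<open>y\<^sub>j\<close> with \<open>j > b\<close> are not yet joined by a rising path. If \<open>y\<^sub>j\<close> is matched
  with \<open>x\<^sub>m\<close>, give the edge \<open>x\<^sub>m y\<^sub>j\<close> the color that comes after that of \<open>x\<^sub>m\<^sub>-\<^sub>1 x\<^sub>m\<close>: then
  \<open>y\<^sub>i, \<dots>, y\<^sub>b, x\<^sub>1, \<dots>, x\<^sub>m, y\<^sub>j\<close> is rising.
\<close>

section \<open>Paths as vertex lists, their edge sequences and reversal\<close>

lemma vpath_iff_successively:
  fixes F :: "'a pair_pre_digraph"
  shows "vpath p F \<longleftrightarrow> p \<noteq> [] \<and> distinct p \<and> set p \<subseteq> pverts F
    \<and> successively (\<lambda>u w. (u, w) \<in> parcs F) p"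
proof -
  have "set (vwalk_arcs p) \<subseteq> parcs F \<longleftrightarrow> successively (\<lambda>u w. (u, w) \<in> parcs F) p"
    by (induction p rule: vwalk_arcs.induct) auto
  then show ?thesis
    by (auto simp: vpath_def vwalk_def)
qed

lemma length_path_edges: "length (path_edges p) = length p - 1"
  by (induction p rule: vwalk_arcs.induct) (auto simp: path_edges_def)

lemma nth_path_edges: "Suc i < length p \<Longrightarrow> path_edges p ! i = {p ! i, p ! Suc i}"
  by (induction p arbitrary: i rule: vwalk_arcs.induct)
    (auto simp: path_edges_def nth_Cons split: nat.split)

lemma path_edges_rev: "path_edges (rev p) = rev (path_edges p)"
  by (rule nth_equalityI)
    (auto simp: length_path_edges nth_path_edges rev_nth Suc_diff_Suc insert_commute)

lemma distance_proper_path_rev: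
  assumes "distance_proper_path l c p"
  shows "distance_proper_path l c (rev p)"
  unfolding distance_proper_path_def
proof (intro allI impI)
  let ?k = "length (path_edges p)"
  fix i j
  assume ij: "i < j \<and> j < length (path_edges (rev p))
    \<and> c (path_edges (rev p) ! i) = c (path_edges (rev p) ! j)"
  then have "i < j" "j < ?k"
    "c (path_edges p ! (?k - Suc i)) = c (path_edges p ! (?k - Suc j))"
    by (auto simp: path_edges_rev rev_nth)
  moreover have "?k - Suc j < ?k - Suc i" "?k - Suc i < ?k"
    using \<open>i < j\<close> \<open>j < ?k\<close> by auto
  ultimately have "\<not> (?k - Suc i) - (?k - Suc j) - 1 < l"
    using assms[unfolded distance_proper_path_def, rule_format, of "?k - Suc j" "?k - Suc i"]
    by (metis (no_types))
  then show "\<not> j - i - 1 < l"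
    using \<open>i < j\<close> \<open>j < ?k\<close> by auto
qed

section \<open>Paths whose colors run cyclically\<close>

definition rising :: "nat \<Rightarrow> ('a set \<Rightarrow> nat) \<Rightarrow> 'a list \<Rightarrow> bool" where
  "rising l c p \<longleftrightarrow>
    (\<exists>s. \<forall>i. Suc i < length p \<longrightarrow> c {p ! i, p ! Suc i} = (s + i) mod (l + 1))"

text \<open>Cyclic colors agree only at positions that differ by a multiple of \<open>l + 1\<close>,
  which leaves at least \<open>l\<close> edges in between.\<close>

lemma rising_imp_distance_proper_path:
  assumes "rising l c p"
  shows "distance_proper_path l c p"
  unfolding distance_proper_path_def
proof (intro allI impI)
  fix i j
  assume ij: "i < j \<and> j < length (path_edges p) \<and> c (path_edges p ! i) = c (path_edges p ! j)"
  obtain s where s: "\<And>i. Suc i < length p \<Longrightarrow> c {p ! i, p ! Suc i} = (s + i) mod (l + 1)"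
    using assms unfolding rising_def by blast
  have "Suc i < length p" "Suc j < length p"
    using ij by (auto simp: length_path_edges)
  then have "(s + j) mod (l + 1) = (s + i) mod (l + 1)"
    using ij s[of i] s[of j] by (metis nth_path_edges)
  then have "l + 1 dvd (s + j) - (s + i)"
    by (rule mod_eq_dvd_iff_nat[THEN iffD1, rotated]) (use ij in simp)
  then have "l + 1 \<le> j - i"
    using ij by (simp add: dvd_imp_le)
  then show "\<not> j - i - 1 < l"
    by simp
qed

lemma rising_drop: "rising l c p \<Longrightarrow> rising l c (drop k p)"
  unfolding rising_def
proof (elim exE)
  fix s assume "\<forall>i. Suc i < length p \<longrightarrow> c {p ! i, p ! Suc i} = (s + i) mod (l + 1)"
  then show "\<exists>s. \<forall>i. Suc i < length (drop k p) \<longrightarrow>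
      c {drop k p ! i, drop k p ! Suc i} = (s + i) mod (l + 1)"
    by (intro exI[of _ "s + k"]) (auto simp: add.assoc)
qed

lemma rising_take: "rising l c p \<Longrightarrow> rising l c (take k p)"
  unfolding rising_def by auto

lemma vpath_drop_take:
  fixes F :: "'a pair_pre_digraph"
  assumes "vpath p F" "i < k" "k \<le> length p"
  shows "vpath (drop i (take k p)) F"
proof -
  have "set (drop i (take k p)) \<subseteq> set p"
    by (meson set_drop_subset set_take_subset subset_trans)
  then show ?thesis
    using assms by (auto simp: vpath_iff_successively successively_conv_nth)
qed

lemma (in pair_graph) vpath_rev:
  assumes "vpath p G"
  shows "vpath (rev p) G"
  using assms arcs_ends_symmetric[OF pair_sym_arcs]
  by (auto simp: vpath_iff_successively elim!: successively_mono)

text \<open>A stretch of a rising path is rising, and its ends are \<open>x\<close> and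
  \<open>y\<close> in one of the two orders. A reversed rising path need not rise, but it is still
  distance proper.\<close>

lemma (in pair_graph) rising_vpath_connects:
  assumes p: "vpath p G" "rising l c p" and xy: "x \<in> set p" "y \<in> set p" "x \<noteq> y"
  shows "\<exists>q. vpath q G \<and> hd q = x \<and> last q = y \<and> distance_proper_path l c q"
proof -
  have sub: "\<exists>q. vpath q G \<and> hd q = p ! i \<and> last q = p ! j \<and> distance_proper_path l c q"
    if "i < j" "j < length p" for i j
  proof (intro exI conjI)
    let ?q = "drop i (take (Suc j) p)"
    show "vpath ?q G"
      using vpath_drop_take[OF p(1)] that by simp
    show "hd ?q = p ! i" "last ?q = p ! j"
      using that by (simp_all add: hd_drop_conv_nth last_conv_nth)
    show "distance_proper_path l c ?q"
      by (intro rising_imp_distance_proper_path rising_drop rising_take p(2))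
  qed
  obtain i j where ij: "i < length p" "j < length p" "p ! i = x" "p ! j = y"
    using xy by (auto simp: in_set_conv_nth)
  with xy(3) consider "i < j" | "j < i"
    by (cases i j rule: linorder_cases) auto
  then show ?thesis
  proof cases
    case 1
    then show ?thesis using sub ij by blast
  next
    case 2
    then obtain q where q: "vpath q G" "hd q = y" "last q = x" "distance_proper_path l c q"
      using sub ij by blast
    then have "hd (rev q) = x" "last (rev q) = y"
      by (auto simp: hd_rev last_rev)
    then show ?thesis
      using q vpath_rev distance_proper_path_rev by blast
  qed
qed

section \<open>The coloring of a spanning spider with center \<open>z\<close>\<close>

text \<open>
  In the proof, \<open>h\<close> rises by one along \<open>A @ z # C\<close> and along \<open>B @ z # C\<close>. A tree edge is colored
  by its lower end. An edge between \<open>C\<close> and \<open>B\<close> off the tree is colored by its higher end, which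
  lies on \<open>C\<close>, and so extends the rising path that arrives there from \<open>A\<close>.
\<close>

lemma (in pair_graph) pc1_spanning_spider:
  assumes AC: "vpath (A @ z # C) G" and BC: "vpath (B @ z # C) G"
    and disj: "set A \<inter> set B = {}"
    and span: "pverts G = set A \<union> set B \<union> insert z (set C)"
    and nbr: "\<And>b. b \<in> set B \<Longrightarrow> \<exists>m \<in> set C. (m, b) \<in> parcs G"
  shows "pc1 l G \<le> l + 1"
proof -
  define pos where "pos p = inv_into {..<length p} ((!) p)" for p :: "'a list"
  have pos: "pos p (p ! i) = i" if "distinct p" "i < length p" for p i
    using that by (auto simp: pos_def inj_on_nth intro!: inv_into_f_f)
  let ?p = "A @ z # C" and ?q = "B @ z # C"
  have dist: "distinct ?p" "distinct ?q"
    using AC BC by (auto simp: vpath_def)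
  \<comment> \<open>The offsets make the two numberings agree from \<open>z\<close> on: both give
    \<open>z\<close> the height \<open>length A + length B\<close>.\<close>
  define h where "h u = (if u \<in> set B then pos ?q u + length A else pos ?p u + length B)" for u
  have hp: "h (?p ! i) = length B + i" if "i < length ?p" for i
  proof -
    have "?p ! i \<in> set ?p" using that by (rule nth_mem)
    then have "?p ! i \<notin> set B" using disj dist by auto
    then show ?thesis using pos[OF dist(1) that] by (simp add: h_def)
  qed
  have hq: "h (?q ! i) = length A + i" if "i < length ?q" for i
  proof (cases "i < length B")
    case True
    then have "?q ! i \<in> set B" by (simp add: nth_append)
    then show ?thesis using pos[OF dist(2) that] by (simp add: h_def)
  next
    case False
    \<comment> \<open>From \<open>z\<close> on, \<open>?q\<close> and \<open>?p\<close> share their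
      vertices; \<open>k\<close> is the index in \<open>?p\<close>.\<close>
    define k where "k = length A + (i - length B)"
    have "k < length ?p" "?q ! i = ?p ! k"
      using False that by (auto simp: k_def nth_append)
    then show ?thesis using hp[of k] False by (simp add: k_def)
  qed
  define T where "T = set (path_edges ?p) \<union> set (path_edges ?q)"
  define c where "c e = (if e \<in> T then Min (h ` e) else Max (h ` e)) mod (l + 1)" for e
  have T: "{?p ! i, ?p ! Suc i} \<in> T" if "Suc i < length ?p" for i
    using that nth_path_edges[of i ?p] nth_mem[of i "path_edges ?p"]
    unfolding T_def length_path_edges by auto
  have T': "{?q ! i, ?q ! Suc i} \<in> T" if "Suc i < length ?q" for i
    using that nth_path_edges[of i ?q] nth_mem[of i "path_edges ?q"]
    unfolding T_def length_path_edges by auto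
  have rp: "c {?p ! i, ?p ! Suc i} = (length B + i) mod (l + 1)" if "Suc i < length ?p" for i
    using T[OF that] hp[of i] hp[of "Suc i"] that by (simp add: c_def)
  have rq: "c {?q ! i, ?q ! Suc i} = (length A + i) mod (l + 1)" if "Suc i < length ?q" for i
    using T'[OF that] hq[of i] hq[of "Suc i"] that by (simp add: c_def)
  \<comment> \<open>This will show that a chord with a height gap of at least two lies outside
    \<open>T\<close>, so that its color comes from \<open>Max\<close>.\<close>
  have T_heights: "\<exists>k. h ` e = {k, Suc k}" if "e \<in> T" for e
  proof -
    have edge: "\<exists>i. Suc i < length r \<and> e = {r ! i, r ! Suc i}"
      if "e \<in> set (path_edges r)" for r
    proof -
      obtain i where i: "i < length (path_edges r)" "path_edges r ! i = e"
        using \<open>e \<in> set (path_edges r)\<close> by (auto simp: in_set_conv_nth)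
      then have "Suc i < length r"
        by (simp add: length_path_edges)
      then show ?thesis
        using nth_path_edges[of i r] i(2) by blast
    qed
    consider i where "Suc i < length ?p" "e = {?p ! i, ?p ! Suc i}"
      | i where "Suc i < length ?q" "e = {?q ! i, ?q ! Suc i}"
      using \<open>e \<in> T\<close> edge unfolding T_def by blast
    then show ?thesis
      using hp hq by cases auto
  qed
  have "rising l c ?p" "rising l c ?q"
    unfolding rising_def using rp rq by blast+
  note connects = rising_vpath_connects[OF AC this(1)] rising_vpath_connects[OF BC this(2)]
  have chord: "\<exists>r. vpath r G \<and> rising l c r \<and> set A \<subseteq> set r \<and> b \<in> set r" if b: "b \<in> set B" for b
  proof -
    obtain m where m: "m \<in> set C" "(m, b) \<in> parcs G"
      using nbr[OF b] by blast
    obtain k where k: "k < length C" "C ! k = m"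
      using m(1) by (auto simp: in_set_conv_nth)
    define j where "j = Suc (length A + k)"
    define r where "r = take (Suc j) ?p @ [b]"
    have j: "j < length ?p" "?p ! j = m"
      using k by (auto simp: j_def nth_append)
    have bnot: "b \<notin> set ?p"
      using b disj dist by auto
    have "successively (\<lambda>u w. (u, w) \<in> parcs G) (take (Suc j) ?p)"
      using vpath_drop_take[OF AC, of 0 "Suc j"] j(1) by (simp add: vpath_iff_successively)
    moreover have "last (take (Suc j) ?p) = m"
      by (simp only: take_Suc_conv_app_nth[OF j(1)] last_snoc j(2))
    moreover have "set (take (Suc j) ?p) \<subseteq> set ?p"
      by (rule set_take_subset)
    ultimately have "vpath r G"
      using bnot m(2) AC b span unfolding r_def vpath_iff_successively
      by (auto simp: successively_append_iff simp del: take_append take_Suc_Cons)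
    moreover have "rising l c r"
      unfolding rising_def
    proof (intro exI allI impI)
      fix i assume i: "Suc i < length r"
      have len: "length (take (Suc j) ?p) = Suc j"
        using j(1) by simp
      have r_nth: "r ! t = ?p ! t" if "t \<le> j" for t
        using that len unfolding r_def by (simp only: nth_append_left nth_take less_Suc_eq_le)
      show "c {r ! i, r ! Suc i} = (length B + i) mod (l + 1)"
      proof (cases "i < j")
        case True
        then show ?thesis using rp[of i] r_nth j(1) by simp
      next
        case False
        then have "i = j" using i len by (simp add: r_def)
        then have r: "r ! i = m" "r ! Suc i = b"
          using r_nth j(2) len nth_append_length[of "take (Suc j) ?p" b "[]"]
          by (simp_all only: r_def)
        have hm: "h m = length B + j"
          using hp[OF j(1)] j(2) by simp
        obtain i' where "i' < length B" "B ! i' = b"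
          using b by (auto simp: in_set_conv_nth)
        \<comment> \<open>\<open>b\<close> lies below \<open>z\<close> and \<open>m\<close> above
          it, so their heights differ by at least two.\<close>
        then have hb: "Suc (Suc (h b)) \<le> h m"
          using hq[of i'] hm by (simp add: nth_append j_def)
        have "{m, b} \<notin> T"
          using T_heights[of "{m, b}"] hb by (auto simp: doubleton_eq_iff)
        then show ?thesis
          using r \<open>i = j\<close> hm hb by (simp add: c_def max_absorb1)
      qed
    qed
    moreover have "set A \<subseteq> set r"
      by (auto simp: r_def j_def)
    moreover have "b \<in> set r"
      by (simp add: r_def)
    ultimately show ?thesis
      by blast
  qed
  have "distance_proper_connected l G c"
    unfolding distance_proper_connected_def
  proof (intro ballI impI)
    fix x y assume xy: "x \<in> pverts G" "y \<in> pverts G" "x \<noteq> y"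
    \<comment> \<open>Two vertices on a common spine \<open>?p\<close> or \<open>?q\<close> need no
      chord; only the pairs between \<open>A\<close> and \<open>B\<close> do.\<close>
    then consider "x \<in> set ?p" "y \<in> set ?p" | "x \<in> set ?q" "y \<in> set ?q"
      | "x \<in> set A" "y \<in> set B" | "x \<in> set B" "y \<in> set A"
      using span by auto
    then show "\<exists>q. vpath q G \<and> hd q = x \<and> last q = y \<and> distance_proper_path l c q"
    proof cases
      case 3
      then show ?thesis using chord rising_vpath_connects[of _ l c x y] xy(3) by blast
    next
      case 4
      then show ?thesis using chord rising_vpath_connects[of _ l c x y] xy(3) by blast
    qed (use connects xy(3) in blast)+
  qed
  then have "pc1 l G \<le> card (c ` uedges G)"
    unfolding pc1_def by (intro Least_le) blast
  also have "\<dots> \<le> card {..l}"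
    by (intro card_mono) (auto simp: c_def less_Suc_eq_le[symmetric])
  finally show ?thesis
    by simp
qed

section \<open>The spider in a permutation graph\<close>

theorem theorem4p3:
  fixes G :: "'a pair_pre_digraph" and v :: "nat \<Rightarrow> 'a" and \<alpha> :: "nat \<Rightarrow> nat" and n l :: nat
  assumes "pair_graph G" and "nontrivial G" and "traceable G"
    and "card (pverts G) = n" and "bij_betw v {1..n} (pverts G)"
    and "l \<ge> 1"
    and "\<alpha> permutes {1..n}"
  shows "pc1 l (permutation_graph v \<alpha> G) \<le> l + 1"
proof -
  let ?P = "permutation_graph v \<alpha> G"
  let ?E = "\<lambda>u w. (u, w) \<in> parcs ?P"
  interpret P: pair_graph ?P
    using assms pair_graph_permutation_graph by blast
  obtain p where p: "vpath p G" "set p = pverts G"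
    using assms(3) by (auto simp: traceable_def)
  then have path: "p \<noteq> []" "distinct p" "successively (\<lambda>u w. (u, w) \<in> parcs G) p"
    by (auto simp: vpath_iff_successively)
  have v: "v ` {1..n} = pverts G"
    using assms(5) by (simp add: bij_betw_def)
  obtain i where i: "i \<in> {1..n}" "hd p = v i"
    using v p(2) path(1) hd_in_set by blast
  have "\<alpha> i \<in> {1..n}"
    using i(1) permutes_in_image[OF assms(7)] by blast
  \<comment> \<open>The copy of \<open>p\<close> is cut at the partner of \<open>hd p\<close>, which
    becomes the center. The leg from \<open>B\<close> is reversed below so that it too runs towards
    the center.\<close>
  then obtain A B where AB: "p = A @ v (\<alpha> i) # B"
    using v p(2) split_list by (metis imageI)
  let ?z = "Inr (v (\<alpha> i))" and ?C = "map Inl p :: ('a + 'a) list"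
  have arcs: "(Inl x, Inl y) \<in> parcs ?P" "(Inr x, Inr y) \<in> parcs ?P"
    if "(x, y) \<in> parcs G" for x y
    using that by (auto simp: permutation_graph_def)
  have matching: "(Inl (v k), Inr (v (\<alpha> k))) \<in> parcs ?P" "(Inr (v (\<alpha> k)), Inl (v k)) \<in> parcs ?P"
    if "k \<in> {1..n}" for k
    using that assms(4) by (auto simp: permutation_graph_def)
  have C: "successively ?E (map Inl p)"
    using path(3) arcs(1) by (auto simp: successively_map elim!: successively_mono)
  have D: "successively ?E (map Inr p)"
    using path(3) arcs(2) by (auto simp: successively_map elim!: successively_mono)
  have D': "successively ?E (rev (map Inr p))"
    unfolding successively_rev using D
    by (rule successively_mono) (use arcs_ends_symmetric[OF P.pair_sym_arcs] in auto)
  have V: "pverts ?P = Inl ` pverts G \<union> Inr ` pverts G"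
    by (simp add: permutation_graph_def)
  have hd_C: "?C \<noteq> []" "hd ?C = Inl (v i)"
    using path(1) i(2) by (simp_all add: hd_map)
  show ?thesis
  proof (rule P.pc1_spanning_spider)
    have zC: "successively ?E (?z # ?C)"
      using C hd_C matching(2)[OF i(1)] by (simp add: successively_Cons)
    have AB': "map Inr p = (map Inr A @ [?z]) @ map Inr B"
      "rev (map Inr p) = (map Inr (rev B) @ [?z]) @ map Inr (rev A)"
      by (simp_all add: AB rev_map)
    have "successively ?E (map Inr A @ [?z])" "successively ?E (map Inr (rev B) @ [?z])"
      using D[unfolded AB'(1)] D'[unfolded AB'(2)] successively_append_iff by metis+
    then have "successively ?E (map Inr A @ ?z # ?C)" "successively ?E (map Inr (rev B) @ ?z # ?C)"
      using zC by (simp_all add: successively_append_iff)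
    moreover have "distinct (map Inr A @ ?z # ?C)" "distinct (map Inr (rev B) @ ?z # ?C)"
      using path(2) by (auto simp: AB distinct_map)
    moreover have "set (map Inr A @ ?z # ?C) \<subseteq> pverts ?P" "set (map Inr (rev B) @ ?z # ?C) \<subseteq> pverts ?P"
      unfolding V p(2)[symmetric] by (auto simp: AB)
    ultimately show "vpath (map Inr A @ ?z # ?C) ?P" "vpath (map Inr (rev B) @ ?z # ?C) ?P"
      by (simp_all only: vpath_iff_successively) simp_all
    show "set (map Inr A) \<inter> set (map Inr (rev B)) = {}"
      using path(2) AB by auto
    show "pverts ?P = set (map Inr A) \<union> set (map Inr (rev B)) \<union> insert ?z (set ?C)"
      using p(2) AB by (auto simp: V)
    fix b assume "b \<in> set (map Inr (rev B) :: ('a + 'a) list)"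
    then obtain w where w: "w \<in> pverts G" "b = Inr w"
      using p(2) AB by auto
    then obtain k where k: "k \<in> {1..n}" "b = Inr (v k)"
      using v by blast
    \<comment> \<open>The partner of \<open>b\<close> has index \<open>inv \<alpha> k\<close>; it
      lies on \<open>?C\<close> because \<open>p\<close> is Hamiltonian.\<close>
    have k': "inv \<alpha> k \<in> {1..n}" "\<alpha> (inv \<alpha> k) = k"
      using k(1) permutes_in_image[OF permutes_inv[OF assms(7)]] permutes_inverses(1)[OF assms(7)]
      by blast+
    then have "Inl (v (inv \<alpha> k)) \<in> set ?C"
      using v p(2) by (metis imageI set_map)
    moreover have "(Inl (v (inv \<alpha> k)), b) \<in> parcs ?P"
      using matching(1)[OF k'(1)] k(2) k'(2) by simp
    ultimately show "\<exists>m \<in> set ?C. (m, b) \<in> parcs ?P"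
      by blast
  qed
qed

end
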